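(* Let $A$ be a ring and let $B$ be a subring of $A$ with the identity element the same as that of $A$. The following statements are equivalent: (1) $A$ and $B$ are $P$-symmetric. (2) $R[A,B]$ is $P$-symmetric.
   Context: Rings are associative with identity (not necessarily commutative). For a ring $A$ and a subring $B$ of $A$ with the same identity element, $R[A,B]$ denotes the set of sequences $\{(a_1,a_2,\dots,a_n,b,b,\dots): a_i\in A,\ b\in B,\ n\geq 1,\ 1\leq i\leq n\}$ (sequences of elements of $A$ that are eventually constant with value in $B$), which is a ring under componentwise addition and multiplication. $P(R)$ denotes the prime radical of a ring $R$ (the intersection of all prime two-sided ideals of $R$). A ring $R$ is $P$-symmetric if for any $a,b,c\in R$, $abc=0$ implies $bac\in P(R)$. *)

theory Defs
  imports "HOL-Algebra.Ideal_Product" "HOL-Algebra.Subrings"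
begin

text \<open>
  The library locale \<open>primeideal\<close> presupposes a commutative ring and is elementwise. For
  arbitrary rings, a proper two-sided ideal is prime if it contains one of two ideals whenever
  it contains their product.
\<close>

locale two_sided_prime_ideal = ideal P R for P and R (structure) +
  assumes proper: "P \<noteq> carrier R"
    and prime: "\<lbrakk> ideal I R; ideal J R; ideal_prod R I J \<subseteq> P \<rbrakk> \<Longrightarrow> I \<subseteq> P \<or> J \<subseteq> P"

text \<open>
  Intersecting with the carrier matters only for the zero ring, which has no prime ideals.
\<close>

definition prime_radical :: "('a, 'm) ring_scheme \<Rightarrow> 'a set" where
  "prime_radical R = carrier R \<inter> \<Inter>{P. two_sided_prime_ideal P R}"

definition P_symmetric :: "('a, 'm) ring_scheme \<Rightarrow> bool" where
  "P_symmetric R \<longleftrightarrow>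
    (\<forall>a\<in>carrier R. \<forall>b\<in>carrier R. \<forall>c\<in>carrier R.
       a \<otimes>\<^bsub>R\<^esub> b \<otimes>\<^bsub>R\<^esub> c = \<zero>\<^bsub>R\<^esub> \<longrightarrow> b \<otimes>\<^bsub>R\<^esub> a \<otimes>\<^bsub>R\<^esub> c \<in> prime_radical R)"

text \<open>
  The ring $R[A,B]$. Sequences are indexed from 0, so the entries $a_1, \dots, a_n$ are the
  values at the indices below \<open>n\<close>.
\<close>

definition seq_ring :: "('a, 'm) ring_scheme \<Rightarrow> 'a set \<Rightarrow> (nat \<Rightarrow> 'a) ring" where
  "seq_ring A B =
    \<lparr> carrier = {f. \<exists>n\<ge>1. \<exists>b\<in>B. (\<forall>i<n. f i \<in> carrier A) \<and> (\<forall>i\<ge>n. f i = b)},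
      mult = (\<lambda>f g i. f i \<otimes>\<^bsub>A\<^esub> g i),
      one = (\<lambda>i. \<one>\<^bsub>A\<^esub>),
      zero = (\<lambda>i. \<zero>\<^bsub>A\<^esub>),
      add = (\<lambda>f g i. f i \<oplus>\<^bsub>A\<^esub> g i) \<rparr>"

lemma seq_ring_carrier_iff:
  assumes "B \<subseteq> carrier A"
  shows "f \<in> carrier (seq_ring A B) \<longleftrightarrow>
    (\<forall>i. f i \<in> carrier A) \<and> (\<exists>b\<in>B. \<exists>n. \<forall>i\<ge>n. f i = b)"
proof
  assume "f \<in> carrier (seq_ring A B)"
  then obtain n b where *: "b \<in> B" "\<forall>i<n. f i \<in> carrier A" "\<forall>i\<ge>n. f i = b"
    by (auto simp: seq_ring_def)
  then have "f i \<in> carrier A" for i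
    using assms by (cases "i < n") auto
  with * show "(\<forall>i. f i \<in> carrier A) \<and> (\<exists>b\<in>B. \<exists>n. \<forall>i\<ge>n. f i = b)"
    by blast
next
  assume "(\<forall>i. f i \<in> carrier A) \<and> (\<exists>b\<in>B. \<exists>n. \<forall>i\<ge>n. f i = b)"
  then obtain n b where *: "\<forall>i. f i \<in> carrier A" "b \<in> B" "\<forall>i\<ge>n. f i = b"
    by auto
  then have "\<forall>i\<ge>Suc n. f i = b"
    by auto
  with * show "f \<in> carrier (seq_ring A B)"
    unfolding seq_ring_def by (auto intro!: exI[of _ "Suc n"] bexI[of _ b])
qed

lemma seq_ring_closed2:
  assumes "B \<subseteq> carrier A"
    and "\<And>x y. x \<in> carrier A \<Longrightarrow> y \<in> carrier A \<Longrightarrow> h x y \<in> carrier A"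
    and "\<And>x y. x \<in> B \<Longrightarrow> y \<in> B \<Longrightarrow> h x y \<in> B"
    and "f \<in> carrier (seq_ring A B)" "g \<in> carrier (seq_ring A B)"
  shows "(\<lambda>i. h (f i) (g i)) \<in> carrier (seq_ring A B)"
proof -
  from assms(4) obtain b n where f: "\<forall>i. f i \<in> carrier A" "b \<in> B" "\<forall>i\<ge>n. f i = b"
    unfolding seq_ring_carrier_iff[OF assms(1)] by blast
  from assms(5) obtain c m where g: "\<forall>i. g i \<in> carrier A" "c \<in> B" "\<forall>i\<ge>m. g i = c"
    unfolding seq_ring_carrier_iff[OF assms(1)] by blast
  have "\<forall>i\<ge>max n m. h (f i) (g i) = h b c"
    using f g by simp
  with f g assms(2,3) show ?thesis
    unfolding seq_ring_carrier_iff[OF assms(1)] by blast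
qed

lemma seq_ring_is_ring:
  fixes A :: "('a, 'm) ring_scheme"
  assumes "ring A" and "subring B A"
  shows "ring (seq_ring A B)"
proof -
  interpret ring A by fact
  note sub = subringE[OF assms(2)]
  note iff = seq_ring_carrier_iff[OF sub(1)]
  have sel: "mult (seq_ring A B) = (\<lambda>f g i. f i \<otimes>\<^bsub>A\<^esub> g i)"
      "one (seq_ring A B) = (\<lambda>i. \<one>\<^bsub>A\<^esub>)"
      "zero (seq_ring A B) = (\<lambda>i. \<zero>\<^bsub>A\<^esub>)"
      "add (seq_ring A B) = (\<lambda>f g i. f i \<oplus>\<^bsub>A\<^esub> g i)"
    by (simp_all add: seq_ring_def)
  have el: "f i \<in> carrier A" if "f \<in> carrier (seq_ring A B)" for f i
    using that iff by blast
  have const: "(\<lambda>i. b) \<in> carrier (seq_ring A B)" if "b \<in> B" for b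
    using that sub(1) unfolding iff by auto
  have neg: "(\<lambda>i. \<ominus>\<^bsub>A\<^esub> f i) \<in> carrier (seq_ring A B)" if "f \<in> carrier (seq_ring A B)" for f
    using seq_ring_closed2[OF sub(1), of "\<lambda>x y. \<ominus>\<^bsub>A\<^esub> x", OF _ _ that that] sub(5) by simp
  show ?thesis
  proof (rule ringI)
    show "abelian_group (seq_ring A B)"
    proof (rule abelian_groupI)
      fix f g assume "f \<in> carrier (seq_ring A B)" "g \<in> carrier (seq_ring A B)"
      then show "f \<oplus>\<^bsub>seq_ring A B\<^esub> g \<in> carrier (seq_ring A B)"
        using seq_ring_closed2[OF sub(1), of "add A"] sub(7) by (simp add: sel)
    next
      fix f assume "f \<in> carrier (seq_ring A B)"
      then show "\<exists>g\<in>carrier (seq_ring A B). g \<oplus>\<^bsub>seq_ring A B\<^esub> f = \<zero>\<^bsub>seq_ring A B\<^esub>"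
        using neg el by (intro bexI[of _ "\<lambda>i. \<ominus>\<^bsub>A\<^esub> f i"]) (auto simp: sel l_neg)
    qed (use const sub in \<open>auto simp: sel el a_ac\<close>)
    show "monoid (seq_ring A B)"
    proof (rule monoidI)
      fix f g assume "f \<in> carrier (seq_ring A B)" "g \<in> carrier (seq_ring A B)"
      then show "f \<otimes>\<^bsub>seq_ring A B\<^esub> g \<in> carrier (seq_ring A B)"
        using seq_ring_closed2[OF sub(1), of "mult A"] sub(6) by (simp add: sel)
    qed (use const sub in \<open>auto simp: sel el m_assoc\<close>)
  qed (auto simp: sel el l_distr r_distr)
qed

end

theory Submission
  imports Defs
begin

text \<open>
  The evaluations at an index and the eventual value are surjective homomorphisms from
  $R[A,B]$ onto \<open>A\<close> and \<open>B\<close>. The ideal of sequences supported at \<open>i\<close> annihilates the kernel of the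
  evaluation at \<open>i\<close>, so a prime ideal contains one of the two; if it contains the former for
  every \<open>i\<close>, it contains all finitely supported sequences, that is, the kernel of the eventual
  value. Hence every prime ideal of $R[A,B]$ is pulled back from a prime ideal of \<open>A\<close> or \<open>B\<close>.
\<close>

section \<open>Ideals and prime ideals under a surjective ring homomorphism\<close>

lemma (in ideal) ideal_prod_subsetI:
  assumes "\<And>i j. i \<in> K \<Longrightarrow> j \<in> J \<Longrightarrow> i \<otimes> j \<in> I"
  shows "ideal_prod R K J \<subseteq> I"
proof
  fix x assume "x \<in> ideal_prod R K J"
  then show "x \<in> I"
    by induction (auto intro: assms)
qed

context ring_hom_ring
begin

lemma ideal_image:
  assumes surj: "h ` carrier R = carrier S" and I: "ideal I R"
  shows "ideal (h ` I) S"
proof (rule idealI)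
  interpret I: ideal I R by fact
  have pre: "\<exists>r\<in>carrier R. x = h r" if "x \<in> carrier S" for x
    using that surj by blast
  show "ring S" ..
  show "subgroup (h ` I) (add_monoid S)"
  proof (rule S.add.subgroupI)
    show "h ` I \<subseteq> carrier S"
      using I.Icarr by auto
    show "h ` I \<noteq> {}"
      using I.zero_closed by blast
    show "\<ominus>\<^bsub>S\<^esub> y \<in> h ` I" if "y \<in> h ` I" for y
      using that by (auto simp: I.Icarr intro!: image_eqI[of _ _ "\<ominus> _"] I.a_inv_closed)
    show "y \<oplus>\<^bsub>S\<^esub> z \<in> h ` I" if "y \<in> h ` I" "z \<in> h ` I" for y z
    proof -
      from that obtain i j where "i \<in> I" "j \<in> I" "y = h i" "z = h j"
        by blast
      then show ?thesis
        by (auto simp: I.Icarr intro!: image_eqI[of _ _ "i \<oplus> j"])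
    qed
  qed
  fix y x assume "y \<in> h ` I" "x \<in> carrier S"
  then obtain i r where *: "i \<in> I" "y = h i" "r \<in> carrier R" "x = h r"
    using pre by blast
  then show "x \<otimes>\<^bsub>S\<^esub> y \<in> h ` I"
    by (auto simp: I.Icarr intro!: image_eqI[of _ _ "r \<otimes> i"] I.I_l_closed)
  from * show "y \<otimes>\<^bsub>S\<^esub> x \<in> h ` I"
    by (auto simp: I.Icarr intro!: image_eqI[of _ _ "i \<otimes> r"] I.I_r_closed)
qed

text \<open>If the product of \<open>I\<close> and \<open>J\<close> lies in the preimage, then the
  product of their images lies in \<open>P\<close>, and primeness of \<open>P\<close> applies.
  Surjectivity matters twice: it makes the images ideals of \<open>S\<close>, and it keeps the
  preimage proper.\<close>

lemma two_sided_prime_ideal_vimage: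
  assumes surj: "h ` carrier R = carrier S" and P: "two_sided_prime_ideal P S"
  shows "two_sided_prime_ideal {r \<in> carrier R. h r \<in> P} R"
proof -
  interpret P: two_sided_prime_ideal P S by fact
  show ?thesis
  proof (intro two_sided_prime_ideal.intro two_sided_prime_ideal_axioms.intro)
    show "ideal {r \<in> carrier R. h r \<in> P} R"
      by (rule ideal_vimage) (rule P.is_ideal)
    show "{r \<in> carrier R. h r \<in> P} \<noteq> carrier R"
    proof
      assume "{r \<in> carrier R. h r \<in> P} = carrier R"
      then have "h ` carrier R \<subseteq> P"
        by blast
      then show False
        using P.proper P.a_subset surj by simp
    qed
    fix I J assume IJ: "ideal I R" "ideal J R" "ideal_prod R I J \<subseteq> {r \<in> carrier R. h r \<in> P}"
    have sub: "I \<subseteq> carrier R" "J \<subseteq> carrier R"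
      using IJ(1,2) by (auto dest: ideal.Icarr)
    have "ideal_prod S (h ` I) (h ` J) \<subseteq> P"
    proof (rule P.ideal_prod_subsetI)
      fix x y assume "x \<in> h ` I" "y \<in> h ` J"
      then obtain i j where ij: "i \<in> I" "j \<in> J" "x = h i" "y = h j"
        by blast
      then have "h (i \<otimes> j) \<in> P"
        using IJ(3) ideal_prod.prod[of i I j J R] by blast
      then show "x \<otimes>\<^bsub>S\<^esub> y \<in> P"
        using ij sub by (auto simp: subset_iff)
    qed
    then have "h ` I \<subseteq> P \<or> h ` J \<subseteq> P"
      using P.prime ideal_image[OF surj] IJ(1,2) by blast
    then show "I \<subseteq> {r \<in> carrier R. h r \<in> P} \<or> J \<subseteq> {r \<in> carrier R. h r \<in> P}"
      using sub by blast
  qed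
qed

text \<open>An ideal containing the kernel is a union of cosets of the kernel: if
  \<open>h x = h q\<close> with \<open>q \<in> I\<close>, then \<open>x \<ominus> q\<close> lies in
  the kernel, so adding \<open>q\<close> back stays in \<open>I\<close>.\<close>

lemma mem_of_image_mem:
  assumes I: "ideal I R" and ker: "a_kernel R S h \<subseteq> I"
    and x: "x \<in> carrier R" "h x \<in> h ` I"
  shows "x \<in> I"
proof -
  interpret I: ideal I R by fact
  from x(2) obtain q where q: "h x = h q" "q \<in> I"
    by (rule imageE)
  have qR: "q \<in> carrier R"
    using q(2) by (rule I.Icarr)
  have "h (x \<ominus> q) = h x \<oplus>\<^bsub>S\<^esub> h (\<ominus> q)"
    unfolding R.minus_eq using x(1) qR by (intro hom_add R.a_inv_closed)
  also have "\<dots> = h q \<oplus>\<^bsub>S\<^esub> \<ominus>\<^bsub>S\<^esub> h q"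
    by (simp only: q(1) hom_a_inv[OF qR])
  also have "\<dots> = \<zero>\<^bsub>S\<^esub>"
    by (intro S.r_neg hom_closed qR)
  finally have "x \<ominus> q \<in> a_kernel R S h"
    unfolding a_kernel_def' using R.minus_closed[OF x(1) qR] by blast
  then have "(x \<ominus> q) \<oplus> q \<in> I"
    using ker q(2) by (meson I.a_closed subsetD)
  then show ?thesis
    using x(1) qR by (simp add: R.minus_eq R.a_assoc R.l_neg)
qed

lemma two_sided_prime_ideal_image:
  assumes surj: "h ` carrier R = carrier S" and P: "two_sided_prime_ideal P R"
    and ker: "a_kernel R S h \<subseteq> P"
  shows "two_sided_prime_ideal (h ` P) S"
proof -
  interpret P: two_sided_prime_ideal P R by fact
  note mem = mem_of_image_mem[OF P.is_ideal ker]
  show ?thesis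
  proof (intro two_sided_prime_ideal.intro two_sided_prime_ideal_axioms.intro)
    show "ideal (h ` P) S"
      by (rule ideal_image[OF surj P.is_ideal])
    show "h ` P \<noteq> carrier S"
    proof
      assume "h ` P = carrier S"
      then have "carrier R \<subseteq> P"
        using mem by auto
      then show False
        using P.proper P.a_subset by simp
    qed
    fix I J assume IJ: "ideal I S" "ideal J S" "ideal_prod S I J \<subseteq> h ` P"
    let ?v = "\<lambda>I. {r \<in> carrier R. h r \<in> I}"
    have img: "K \<subseteq> h ` P" if K: "ideal K S" "?v K \<subseteq> P" for K
    proof
      fix y assume "y \<in> K"
      then obtain x where "x \<in> carrier R" "y = h x"
        using ideal.Icarr[OF K(1)] surj by (metis imageE)
      then show "y \<in> h ` P"
        using \<open>y \<in> K\<close> K(2) by (auto simp: subset_iff)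
    qed
    have "ideal_prod R (?v I) (?v J) \<subseteq> P"
    proof (rule P.ideal_prod_subsetI)
      fix i j assume ij: "i \<in> ?v I" "j \<in> ?v J"
      then have "h (i \<otimes> j) \<in> h ` P"
        using IJ(3) ideal_prod.prod[of "h i" I "h j" J S] by auto
      then show "i \<otimes> j \<in> P"
        using ij by (auto intro: mem)
    qed
    then have "?v I \<subseteq> P \<or> ?v J \<subseteq> P"
      using P.prime[OF ideal_vimage[OF IJ(1)] ideal_vimage[OF IJ(2)]] by blast
    then show "I \<subseteq> h ` P \<or> J \<subseteq> h ` P"
      using img[OF IJ(1)] img[OF IJ(2)] by argo
  qed
qed

text \<open>Each prime ideal of \<open>S\<close> pulls back to a prime ideal of \<open>R\<close>,
  which contains \<open>x\<close>.\<close>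

lemma prime_radical_image:
  assumes "h ` carrier R = carrier S" and x: "x \<in> prime_radical R"
  shows "h x \<in> prime_radical S"
  using x two_sided_prime_ideal_vimage[OF assms(1)] unfolding prime_radical_def by fastforce

text \<open>A prime ideal above the kernel can be tested in \<open>S\<close>: its image is prime
  there, hence contains \<open>h x\<close>, and membership lifts back along
  \<open>h\<close>.\<close>

lemma mem_prime_of_image_prime_radical:
  assumes "h ` carrier R = carrier S" "two_sided_prime_ideal P R" "a_kernel R S h \<subseteq> P"
    and "x \<in> carrier R" "h x \<in> prime_radical S"
  shows "x \<in> P"
  using assms two_sided_prime_ideal_image[OF assms(1-3)] mem_of_image_mem[of P x]
  unfolding prime_radical_def two_sided_prime_ideal_def by blast

end

section \<open>Evaluations and the eventual value as homomorphisms\<close>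

lemma seq_ring_simps [simp]:
  "mult (seq_ring A B) = (\<lambda>f g i. f i \<otimes>\<^bsub>A\<^esub> g i)"
  "one (seq_ring A B) = (\<lambda>i. \<one>\<^bsub>A\<^esub>)"
  "zero (seq_ring A B) = (\<lambda>i. \<zero>\<^bsub>A\<^esub>)"
  "add (seq_ring A B) = (\<lambda>f g i. f i \<oplus>\<^bsub>A\<^esub> g i)"
  by (simp_all add: seq_ring_def)

text \<open>Sequences that are not eventually constant get an unspecified value; the homomorphism is
  used only on the carrier of \<open>seq_ring\<close>.\<close>

definition eventual_value :: "(nat \<Rightarrow> 'a) \<Rightarrow> 'a" where
  "eventual_value f = (THE b. \<exists>n. \<forall>i\<ge>n. f i = b)"

lemma eventual_value_eqI:
  assumes "\<forall>i\<ge>n. f i = b"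
  shows "eventual_value f = b"
  unfolding eventual_value_def
proof (rule the_equality)
  fix c assume "\<exists>m. \<forall>i\<ge>m. f i = c"
  then obtain m where "\<forall>i\<ge>m. f i = c" ..
  then show "c = b"
    \<comment> \<open>Both tails contain the index \<open>max n m\<close>, where they must
      agree.\<close>
    using assms by (metis max.cobounded1 max.cobounded2)
qed (use assms in blast)

locale seq_ring_over = ring A for A (structure) and B +
  assumes subring: "subring B A"
begin

lemmas carrier_iff = seq_ring_carrier_iff[OF subringE(1)[OF subring]]

lemma const_closed: "b \<in> B \<Longrightarrow> (\<lambda>i. b) \<in> carrier (seq_ring A B)"
  using subringE(1)[OF subring] unfolding carrier_iff by auto

text \<open>Constant sequences realise only elements of \<open>B\<close>. A single nonzero entry may
  be any element of \<open>A\<close>, since the tail is then zero, which lies in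
  \<open>B\<close>.\<close>

definition single :: "nat \<Rightarrow> 'a \<Rightarrow> nat \<Rightarrow> 'a" where
  "single i a = (\<lambda>j. if j = i then a else \<zero>)"

lemma single_closed: "a \<in> carrier A \<Longrightarrow> single i a \<in> carrier (seq_ring A B)"
  unfolding carrier_iff single_def
  using subringE(2)[OF subring] by (auto intro!: bexI[of _ \<zero>] exI[of _ "Suc i"])

lemma eventually_eq:
  assumes "f \<in> carrier (seq_ring A B)"
  obtains n where "\<forall>i\<ge>n. f i = eventual_value f" "eventual_value f \<in> B"
proof -
  from assms obtain b n where "b \<in> B" "\<forall>i\<ge>n. f i = b"
    unfolding carrier_iff by blast
  then show thesis
    using that[of n] eventual_value_eqI[of n f b] by simp
qed

lemma eval_hom: "ring_hom_ring (seq_ring A B) A (\<lambda>f. f i)"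
  by (rule ring_hom_ringI[OF seq_ring_is_ring[OF ring_axioms subring] ring_axioms])
    (auto simp: carrier_iff)

lemma eval_surj: "(\<lambda>f. f i) ` carrier (seq_ring A B) = carrier A"
proof (intro equalityI subsetI)
  fix a assume "a \<in> carrier A"
  then show "a \<in> (\<lambda>f. f i) ` carrier (seq_ring A B)"
    by (intro image_eqI[OF _ single_closed[of a i]]) (simp add: single_def)
qed (auto simp: carrier_iff)

text \<open>Keeping \<open>h\<close> arbitrary covers addition and multiplication at once.\<close>

lemma eventual_value_binop:
  assumes f: "f \<in> carrier (seq_ring A B)" and g: "g \<in> carrier (seq_ring A B)"
  shows "eventual_value (\<lambda>i. h (f i) (g i)) = h (eventual_value f) (eventual_value g)"
proof -
  obtain n where n: "\<forall>i\<ge>n. f i = eventual_value f"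
    using eventually_eq[OF f] by blast
  obtain m where m: "\<forall>i\<ge>m. g i = eventual_value g"
    using eventually_eq[OF g] by blast
  show ?thesis
    by (rule eventual_value_eqI[of "max n m"]) (simp add: n m)
qed

lemma eventual_value_const [simp]: "eventual_value (\<lambda>i. b) = b"
  by (rule eventual_value_eqI) simp

lemma eventual_value_closed: "f \<in> carrier (seq_ring A B) \<Longrightarrow> eventual_value f \<in> B"
  using eventually_eq by blast

lemma eventual_value_hom: "ring_hom_ring (seq_ring A B) (A\<lparr>carrier := B\<rparr>) eventual_value"
  by (rule ring_hom_ringI[OF seq_ring_is_ring[OF ring_axioms subring] subring_is_ring[OF subring]])
    (simp_all add: eventual_value_closed eventual_value_binop)

lemma eventual_value_surj: "eventual_value ` carrier (seq_ring A B) = carrier (A\<lparr>carrier := B\<rparr>)"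
  using eventual_value_closed by (force intro: image_eqI[OF _ const_closed])

section \<open>Prime ideals and the prime radical of \<open>seq_ring A B\<close>\<close>

lemma supported_at_ideal:
  "ideal {f \<in> carrier (seq_ring A B). \<forall>j. j \<noteq> i \<longrightarrow> f j = \<zero>} (seq_ring A B)"
proof -
  interpret S: ring "seq_ring A B"
    by (rule seq_ring_is_ring[OF ring_axioms subring])
  \<comment> \<open>An intersection of preimages under evaluations: of the whole ring at index
    \<open>i\<close>, and of the zero ideal at every other index.\<close>
  have eq: "{f \<in> carrier (seq_ring A B). \<forall>j. j \<noteq> i \<longrightarrow> f j = \<zero>}
    = (\<Inter>j. {f \<in> carrier (seq_ring A B). f j \<in> (if j = i then carrier A else {\<zero>})})"
    by (auto simp: carrier_iff split: if_splits)
  show ?thesis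
    unfolding eq
  proof (rule S.i_Intersect)
    fix I
    assume "I \<in> range (\<lambda>j. {f \<in> carrier (seq_ring A B). f j \<in> (if j = i then carrier A else {\<zero>})})"
    then show "ideal I (seq_ring A B)"
      using ring_hom_ring.ideal_vimage[OF eval_hom] zeroideal oneideal by auto
  qed simp
qed

lemma prime_contains_kernel:
  assumes "two_sided_prime_ideal Q (seq_ring A B)"
  obtains i where "a_kernel (seq_ring A B) A (\<lambda>f. f i) \<subseteq> Q"
  | "a_kernel (seq_ring A B) (A\<lparr>carrier := B\<rparr>) eventual_value \<subseteq> Q"
proof (cases "\<exists>i. a_kernel (seq_ring A B) A (\<lambda>f. f i) \<subseteq> Q")
  case False
  interpret Q: two_sided_prime_ideal Q "seq_ring A B" by fact
  have supp: "f \<in> Q" if f: "f \<in> carrier (seq_ring A B)" "\<forall>j. j \<noteq> i \<longrightarrow> f j = \<zero>" for f i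
  proof -
    let ?I = "{f \<in> carrier (seq_ring A B). \<forall>j. j \<noteq> i \<longrightarrow> f j = \<zero>}"
    \<comment> \<open>One factor vanishes off \<open>i\<close> and the other at \<open>i\<close>, so
      their product is zero at every index.\<close>
    have "ideal_prod (seq_ring A B) ?I (a_kernel (seq_ring A B) A (\<lambda>f. f i)) \<subseteq> Q"
    proof (rule Q.ideal_prod_subsetI)
      fix f g assume "f \<in> ?I" and "g \<in> a_kernel (seq_ring A B) A (\<lambda>f. f i)"
      then have fg: "\<And>j. f j \<in> carrier A" "\<And>j. g j \<in> carrier A" "\<And>j. j \<noteq> i \<Longrightarrow> f j = \<zero>" "g i = \<zero>"
        by (auto simp: a_kernel_def' carrier_iff)
      have "f j \<otimes> g j = \<zero>" for j
        using fg by (cases "j = i") simp_all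
      then have "f \<otimes>\<^bsub>seq_ring A B\<^esub> g = \<zero>\<^bsub>seq_ring A B\<^esub>"
        by simp
      then show "f \<otimes>\<^bsub>seq_ring A B\<^esub> g \<in> Q"
        using additive_subgroup.zero_closed[OF Q.is_additive_subgroup] by simp
    qed
    \<comment> \<open>The case assumption rules out that \<open>Q\<close> contains the kernel of the
      evaluation at \<open>i\<close>, so primeness leaves only \<open>?I\<close>.\<close>
    then have "?I \<subseteq> Q"
      using Q.prime[OF supported_at_ideal ring_hom_ring.kernel_is_ideal[OF eval_hom]] False by blast
    then show ?thesis
      using f by blast
  qed
  \<comment> \<open>Finitely supported sequences are sums of sequences supported at one index. The
    induction splits off the last possibly nonzero entry, which sits at index \<open>n\<close> when
    \<open>f\<close> vanishes from \<open>Suc n\<close> on.\<close>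
  have "f \<in> Q" if "f \<in> carrier (seq_ring A B)" "\<forall>j\<ge>n. f j = \<zero>" for f n
    using that
  proof (induction n arbitrary: f)
    case 0
    then show ?case
      using supp[of f 0] by blast
  next
    case (Suc n)
    let ?g = "f(n := \<zero>)"
    have el: "f j \<in> carrier A" for j
      using Suc.prems by (simp add: carrier_iff)
    have z: "\<forall>j\<ge>n. ?g j = \<zero>"
      using Suc.prems(2) by (simp add: Suc_le_eq)
    have "?g \<in> carrier (seq_ring A B)"
      unfolding carrier_iff
    proof
      show "\<forall>i. ?g i \<in> carrier A"
        using el by simp
      show "\<exists>b\<in>B. \<exists>n. \<forall>i\<ge>n. ?g i = b"
        using z subringE(2)[OF subring] by blast
    qed
    then have g: "?g \<in> Q"
      using z by (rule Suc.IH)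
    have s: "single n (f n) \<in> Q"
      by (rule supp[OF single_closed[OF el], of n]) (simp add: single_def)
    have "f = ?g \<oplus>\<^bsub>seq_ring A B\<^esub> single n (f n)"
      using el by (auto simp: single_def)
    then show ?case
      using additive_subgroup.a_closed[OF Q.is_additive_subgroup g s] by simp
  qed
  note fin = this
  have "f \<in> Q" if f: "f \<in> a_kernel (seq_ring A B) (A\<lparr>carrier := B\<rparr>) eventual_value" for f
  proof -
    have f': "f \<in> carrier (seq_ring A B)" "eventual_value f = \<zero>"
      using f by (auto simp: a_kernel_def')
    then obtain n where "\<forall>i\<ge>n. f i = \<zero>"
      using eventually_eq by metis
    then show ?thesis
      by (rule fin[OF f'(1)])
  qed
  then show thesis
    using that(2) by blast
qed (use that(1) in blast)

text \<open>Surjective homomorphisms carry the prime radical into the prime radical. Conversely,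
  every prime ideal contains the kernel of an evaluation or of \<open>eventual_value\<close>, so
  membership in it can be tested in \<open>A\<close> or in \<open>B\<close>.\<close>

lemma mem_prime_radical_iff:
  "x \<in> prime_radical (seq_ring A B) \<longleftrightarrow> x \<in> carrier (seq_ring A B) \<and>
    (\<forall>i. x i \<in> prime_radical A) \<and> eventual_value x \<in> prime_radical (A\<lparr>carrier := B\<rparr>)"
proof safe
  assume x: "x \<in> prime_radical (seq_ring A B)"
  show "x \<in> carrier (seq_ring A B)"
    using x by (simp add: prime_radical_def)
  show "x i \<in> prime_radical A" for i
    by (rule ring_hom_ring.prime_radical_image[OF eval_hom eval_surj x])
  show "eventual_value x \<in> prime_radical (A\<lparr>carrier := B\<rparr>)"
    by (rule ring_hom_ring.prime_radical_image[OF eventual_value_hom eventual_value_surj x])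
next
  assume x: "x \<in> carrier (seq_ring A B)" "\<forall>i. x i \<in> prime_radical A"
    "eventual_value x \<in> prime_radical (A\<lparr>carrier := B\<rparr>)"
  have "x \<in> Q" if Q: "two_sided_prime_ideal Q (seq_ring A B)" for Q
    using Q
  proof (cases rule: prime_contains_kernel)
    case (1 i)
    show ?thesis
      by (rule ring_hom_ring.mem_prime_of_image_prime_radical[OF eval_hom eval_surj Q 1 x(1)])
        (use x(2) in blast)
  next
    case 2
    show ?thesis
      by (rule ring_hom_ring.mem_prime_of_image_prime_radical
          [OF eventual_value_hom eventual_value_surj Q 2 x(1)]) (rule x(3))
  qed
  then show "x \<in> prime_radical (seq_ring A B)"
    using x(1) by (simp add: prime_radical_def)
qed

section \<open>Transfer of P-symmetry in both directions\<close>

lemma P_symmetric_seq_ring: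
  assumes A: "P_symmetric A" and B: "P_symmetric (A\<lparr>carrier := B\<rparr>)"
  shows "P_symmetric (seq_ring A B)"
  unfolding P_symmetric_def
proof (intro ballI impI)
  interpret L: ring_hom_ring "seq_ring A B" "A\<lparr>carrier := B\<rparr>" eventual_value
    by (rule eventual_value_hom)
  fix f g h
  assume car: "f \<in> carrier (seq_ring A B)" "g \<in> carrier (seq_ring A B)" "h \<in> carrier (seq_ring A B)"
    and 0: "f \<otimes>\<^bsub>seq_ring A B\<^esub> g \<otimes>\<^bsub>seq_ring A B\<^esub> h = \<zero>\<^bsub>seq_ring A B\<^esub>"
  have "g i \<otimes> f i \<otimes> h i \<in> prime_radical A" for i
    using A car fun_cong[OF 0, of i] by (simp add: P_symmetric_def carrier_iff)
  \<comment> \<open>Products are kept as products of \<open>seq_ring\<close> rather than unfolded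
    pointwise, so that multiplicativity of \<open>eventual_value\<close> applies.\<close>
  moreover have "eventual_value f \<otimes> eventual_value g \<otimes> eventual_value h = \<zero>"
    using arg_cong[OF 0, of eventual_value] car
    by (simp del: seq_ring_simps)
  then have "eventual_value (g \<otimes>\<^bsub>seq_ring A B\<^esub> f \<otimes>\<^bsub>seq_ring A B\<^esub> h)
      \<in> prime_radical (A\<lparr>carrier := B\<rparr>)"
    using B car by (simp add: P_symmetric_def eventual_value_closed del: seq_ring_simps)
  ultimately show "g \<otimes>\<^bsub>seq_ring A B\<^esub> f \<otimes>\<^bsub>seq_ring A B\<^esub> h \<in> prime_radical (seq_ring A B)"
    unfolding mem_prime_radical_iff using car by (auto simp del: seq_ring_simps) simp
qed

text \<open>Triples from \<open>A\<close> are placed at index 0, as their constant sequences may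
  fall outside the ring; triples from \<open>B\<close> become constant sequences, whose eventual
  value recovers the entry.\<close>

lemma P_symmetric_of_seq_ring:
  assumes S: "P_symmetric (seq_ring A B)"
  shows "P_symmetric A" "P_symmetric (A\<lparr>carrier := B\<rparr>)"
proof -
  have comp: "g i \<otimes> f i \<otimes> h i \<in> prime_radical A"
    "eventual_value (\<lambda>i. g i \<otimes> f i \<otimes> h i) \<in> prime_radical (A\<lparr>carrier := B\<rparr>)"
    if "f \<in> carrier (seq_ring A B)" "g \<in> carrier (seq_ring A B)" "h \<in> carrier (seq_ring A B)"
      "\<And>i. f i \<otimes> g i \<otimes> h i = \<zero>" for f g h i
  proof -
    have "(\<lambda>i. g i \<otimes> f i \<otimes> h i) \<in> prime_radical (seq_ring A B)"
      using S that by (auto simp: P_symmetric_def)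
    then show "g i \<otimes> f i \<otimes> h i \<in> prime_radical A"
      "eventual_value (\<lambda>i. g i \<otimes> f i \<otimes> h i) \<in> prime_radical (A\<lparr>carrier := B\<rparr>)"
      by (auto simp: mem_prime_radical_iff)
  qed
  show "P_symmetric A"
    unfolding P_symmetric_def
  proof (intro ballI impI)
    fix a b c
    assume "a \<in> carrier A" "b \<in> carrier A" "c \<in> carrier A" "a \<otimes> b \<otimes> c = \<zero>"
    then show "b \<otimes> a \<otimes> c \<in> prime_radical A"
      \<comment> \<open>At every index other than 0 all three sequences are zero, so the product
        vanishes there as well.\<close>
      using comp(1)[of "single 0 a" "single 0 b" "single 0 c" 0]
      by (simp add: single_closed) (simp add: single_def)
  qed
  show "P_symmetric (A\<lparr>carrier := B\<rparr>)"
    unfolding P_symmetric_def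
    using comp(2)[OF const_closed const_closed const_closed] by simp
qed

end

theorem theorem2p22:
  fixes A :: "('a, 'm) ring_scheme" and B :: "'a set"
  assumes "ring A" and "subring B A"
  shows "(P_symmetric A \<and> P_symmetric (A\<lparr>carrier := B\<rparr>)) \<longleftrightarrow> P_symmetric (seq_ring A B)"
proof -
  interpret seq_ring_over A B
    using assms by (intro seq_ring_over.intro seq_ring_over_axioms.intro)
  show ?thesis
    using P_symmetric_seq_ring P_symmetric_of_seq_ring by blast
qed

end
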